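(* Let $\Theta_h=(A,c,b^\top)$ be an $s$-stage Runge--Kutta method with coefficient matrix $A\in\mathbb{R}^{s\times s}$, weights $b\in\mathbb{R}^s$ and pairwise distinct nodes $c=A\mathbf{1}$, and suppose $\Theta_h$ has order at least $s$. Let $\Phi_h$ be the $s$-stage Runge--Kutta method with matrix $A_1=2A$, nodes $c_1=2c$ and weights $b_1^\top$ such that the quadrature formula with nodes $c_1$ and weights $b_1$ has order at least $s$. Let $\Psi_h$ be the $s$-stage Runge--Kutta method with matrix $A_2=2A-\mathbf{1}b_1^\top$, nodes $c_2=2c-\mathbf{1}$ and weights $b_2^\top$ such that the quadrature formula with nodes $c_2$ and weights $b_2$ has order at least $s$. Then the composition $\Psi_{h/2}\circ\Phi_{h/2}$ is equivalent to $\Theta_h$.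
   Context: $\mathbf{1}\in\mathbb{R}^s$ is the vector with all entries equal to $1$. An $s$-stage Runge--Kutta method $(A,c,b^\top)$, $A=(a_{ij})$, with stepsize $h$ applied to $y'=f(y)$ maps $y_0$ to $y_1=y_0+h\sum_i b_i f(Y_i)$, where the stages solve $Y_i=y_0+h\sum_j a_{ij}f(Y_j)$, $i=1,\dots,s$ (for smooth $f$ and sufficiently small $|h|$, the solution near $y_0$ is taken). The same letter denotes the method and its one-step map; in $\Psi_{h/2}\circ\Phi_{h/2}$ the map $\Phi_{h/2}$ is applied first. A quadrature formula on $[0,1]$ with nodes $\gamma=(\gamma_i)$ and weights $\beta=(\beta_i)$ has order at least $s$ if $\sum_{i=1}^s\beta_i\gamma_i^{k-1}=\frac1k$ for $k=1,\dots,s$. (For distinct nodes this determines the weights uniquely.) Two Runge--Kutta methods are equivalent if they define the same one-step map for every smooth $f$ and every sufficiently small $|h|$. *)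

theory Defs
  imports "HOL-Analysis.Analysis" "HOL-Analysis.Finite_Function_Topology"
begin

text \<open>
  The order of a Runge--Kutta method quantifies over differential equations in all dimensions
  at once, so \<open>\<real>\<^sup>n\<close> cannot be a type here.  It is the subspace \<open>Rn n\<close> of the normed space of
  finitely supported sequences, whose norm is the sum of the absolute values of the coordinates.
  Stages, in contrast, are indexed by a fixed finite type \<open>'s\<close> with \<open>s = CARD('s)\<close>.
\<close>

type_synonym fvec = "nat \<Rightarrow>\<^sub>0 real"

definition Rn :: "nat \<Rightarrow> fvec set" where
  "Rn n = {x. Poly_Mapping.keys x \<subseteq> {..<n}}"

text \<open>Being \<open>C\<^sup>k\<close> on \<open>Rn n\<close>, in terms of iterated partial derivatives; \<open>g\<close> is the \<open>i\<close>-th one.\<close>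

primrec Ck_on_Rn :: "nat \<Rightarrow> nat \<Rightarrow> (fvec \<Rightarrow> fvec) \<Rightarrow> bool" where
  "Ck_on_Rn n 0 f \<longleftrightarrow> continuous_on (Rn n) f"
| "Ck_on_Rn n (Suc k) f \<longleftrightarrow> continuous_on (Rn n) f \<and>
     (\<forall>i<n. \<exists>g. (\<forall>x\<in>Rn n.
          ((\<lambda>t. f (x + t *\<^sub>R Poly_Mapping.single i 1)) has_vector_derivative g x) (at 0))
        \<and> Ck_on_Rn n k g)"

definition smooth_field :: "nat \<Rightarrow> (fvec \<Rightarrow> fvec) \<Rightarrow> bool" where
  "smooth_field n f \<longleftrightarrow> f \<in> Rn n \<rightarrow> Rn n \<and> (\<forall>k. Ck_on_Rn n k f)"

definition local_solution :: "nat \<Rightarrow> (fvec \<Rightarrow> fvec) \<Rightarrow> fvec \<Rightarrow> (real \<Rightarrow> fvec) \<Rightarrow> bool" where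
  "local_solution n f y0 y \<longleftrightarrow> y 0 = y0 \<and>
     (\<forall>\<^sub>F t in nhds 0. y t \<in> Rn n \<and> (y has_vector_derivative f (y t)) (at t))"

definition rk_stages ::
    "real^'s^'s \<Rightarrow> nat \<Rightarrow> (fvec \<Rightarrow> fvec) \<Rightarrow> real \<Rightarrow> fvec \<Rightarrow> ('s \<Rightarrow> fvec) \<Rightarrow> bool" where
  "rk_stages A n f h y0 Y \<longleftrightarrow>
     (\<forall>i. Y i \<in> Rn n \<and> Y i = y0 + h *\<^sub>R (\<Sum>j\<in>UNIV. A $ i $ j *\<^sub>R f (Y j)))"

text \<open>
  A one-step map takes the dimension \<open>n\<close>, the field \<open>f\<close>, a radius \<open>r\<close>, the stepsize \<open>h\<close> and the
  initial value.  The radius makes ``the solution near \<open>y0\<close> is taken'' precise: the step is defined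
  if exactly one solution of the stage equations lies within distance \<open>r\<close> of \<open>y0\<close>.  For smooth
  \<open>f\<close> and every \<open>r > 0\<close> this is the case for all sufficiently small \<open>\<bar>h\<bar>\<close>, and by uniqueness
  any two radii give the same step once \<open>\<bar>h\<bar>\<close> is small enough.
\<close>

type_synonym one_step = "nat \<Rightarrow> (fvec \<Rightarrow> fvec) \<Rightarrow> real \<Rightarrow> real \<Rightarrow> fvec \<rightharpoonup> fvec"

definition rk_map :: "real^'s^'s \<Rightarrow> real^'s \<Rightarrow> one_step" where
  "rk_map A b n f r h y0 =
     (let near = (\<lambda>Y. rk_stages A n f h y0 Y \<and> (\<forall>i. dist (Y i) y0 < r))
      in if \<exists>!Y. near Y
         then Some (y0 + h *\<^sub>R (\<Sum>i\<in>UNIV. b $ i *\<^sub>R f ((THE Y. near Y) i)))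
         else None)"

text \<open>\<open>M\<^bsub>h/2\<^esub> \<circ> N\<^bsub>h/2\<^esub>\<close>; \<open>N\<close> is applied first.\<close>

definition half_step_comp :: "one_step \<Rightarrow> one_step \<Rightarrow> one_step" where
  "half_step_comp M N n f r h = M n f r (h / 2) \<circ>\<^sub>m N n f r (h / 2)"

text \<open>
  Order at least \<open>p\<close>: the error after one step started on an exact solution is \<open>O(h\<^bsup>p+1\<^esup>)\<close>.
\<close>

definition order_at_least :: "one_step \<Rightarrow> nat \<Rightarrow> bool" where
  "order_at_least M p \<longleftrightarrow>
     (\<forall>n f y0 y. smooth_field n f \<longrightarrow> y0 \<in> Rn n \<longrightarrow> local_solution n f y0 y \<longrightarrow>
       (\<forall>r>0. \<exists>C. \<forall>\<^sub>F h in nhds 0.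
          \<exists>y1. M n f r h y0 = Some y1 \<and> norm (y1 - y h) \<le> C * \<bar>h\<bar> ^ (p + 1)))"

text \<open>
  Equality of one-step maps for sufficiently small \<open>\<bar>h\<bar>\<close>, the bound on \<open>\<bar>h\<bar>\<close> being uniform for
  initial values in a compact set.  Both maps are required to be defined there.
\<close>

definition one_step_equivalent :: "one_step \<Rightarrow> one_step \<Rightarrow> bool" where
  "one_step_equivalent M N \<longleftrightarrow>
     (\<forall>n f K. smooth_field n f \<longrightarrow> compact K \<longrightarrow> K \<subseteq> Rn n \<longrightarrow>
       (\<forall>r>0. \<forall>\<^sub>F h in nhds 0. \<forall>y0\<in>K.
          \<exists>y1. M n f r h y0 = Some y1 \<and> N n f r h y0 = Some y1))"

definition quadrature_order_at_least :: "real^'s \<Rightarrow> real^'s \<Rightarrow> nat \<Rightarrow> bool" where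
  "quadrature_order_at_least \<gamma> \<beta> p \<longleftrightarrow>
     (\<forall>k\<in>{1..p}. (\<Sum>i\<in>UNIV. \<beta> $ i * \<gamma> $ i ^ (k - 1)) = 1 / real k)"

end

theory Submission
  imports Defs
begin

text \<open>
  The stages of all three methods are the same vectors. Write \<open>Y\<close> for the stages of \<open>\<Theta>\<^sub>h\<close> from
  \<open>y0\<close>. Halving the step and doubling the matrix cancel, so \<open>Y\<close> are also the stages of \<open>\<Phi>\<close> at \<open>h/2\<close>
  (\<open>rk_stages_rescale\<close>), which hence ends at \<open>y0 + (h/2) \<Sum> b1\<^sub>i f(Y\<^sub>i)\<close>. In the stage equations of
  \<open>\<Psi>\<close> the term \<open>- b1\<^sub>j\<close> in every row of \<open>A2\<close> moves the base point from there back to \<open>y0\<close>, so \<open>Y\<close>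
  solves them as well (\<open>rk_stages_second_half\<close>). The composition therefore ends at
  \<open>y0 + h \<Sum> (b1\<^sub>i + b2\<^sub>i)/2 f(Y\<^sub>i)\<close>, and it remains to see that \<open>b1 + b2 = 2 b\<close>.

  This is an identity between quadrature weights at the distinct nodes \<open>c\<close>
  (\<open>split_quadrature_weights\<close>): rescaled to \<open>[0,1/2]\<close> and \<open>[1/2,1]\<close>, the two given formulas both
  use the nodes \<open>c\<close>, and their sum, with weights \<open>(b1 + b2)/2\<close>, integrates polynomials of degree
  below \<open>s\<close> exactly over \<open>[0,1]\<close>. So does \<open>b\<close>: the order of a Runge--Kutta method, tested on the
  pure quadrature problems \<open>x' = 1, y' = x\<^sup>m\<close>, is at most the order of its quadrature formula
  (\<open>order_imp_quadrature_order\<close>). The weights of such a formula are unique.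

  The analytic part makes ``the stages near \<open>y0\<close>'' meaningful: for small \<open>\<bar>h\<bar>\<close>, uniformly for \<open>y0\<close>
  in a cube, the stage equations have exactly one solution near \<open>y0\<close> (\<open>eventually_unique_stages\<close>),
  by Banach's fixed point theorem and the Lipschitz continuity of \<open>f\<close> on cubes.
\<close>

section \<open>The norm and the coordinates of finitely supported sequences\<close>

lemma lookup_scaleR: "Poly_Mapping.lookup (r *\<^sub>R x) i = r *\<^sub>R Poly_Mapping.lookup x i"
  by (simp add: scaleR_poly_mapping_def)

lemma norm_fvec: "norm x = (\<Sum>k\<in>Poly_Mapping.keys x. \<bar>Poly_Mapping.lookup x k\<bar>)" for x :: fvec
  by (simp add: norm_poly_mapping_def dist_poly_mapping_def)

lemma norm_on_Rn:
  assumes "x \<in> Rn n"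
  shows "norm x = (\<Sum>k<n. \<bar>Poly_Mapping.lookup x k\<bar>)"
  unfolding norm_fvec using assms
  by (intro sum.mono_neutral_left) (auto simp: Rn_def in_keys_iff)

lemma abs_lookup_le_norm: "\<bar>Poly_Mapping.lookup x i\<bar> \<le> norm x" for x :: fvec
proof (cases "i \<in> Poly_Mapping.keys x")
  case True
  then show ?thesis
    unfolding norm_fvec by (intro member_le_sum) auto
next
  case False
  then show ?thesis by (simp add: in_keys_iff)
qed

lemma bounded_linear_lookup: "bounded_linear (\<lambda>x::fvec. Poly_Mapping.lookup x i)"
  by (rule bounded_linear_intro[of _ 1]) (simp_all add: lookup_add lookup_scaleR abs_lookup_le_norm)

lemma mem_Rn: "x \<in> Rn n \<longleftrightarrow> (\<forall>i\<ge>n. Poly_Mapping.lookup x i = 0)"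
  unfolding Rn_def subset_iff in_keys_iff by (auto simp: not_less) (metis leI)

lemma single_mem_Rn: "i < n \<Longrightarrow> Poly_Mapping.single i a \<in> Rn n"
  by (simp add: mem_Rn lookup_single when_def)

lemma subspace_Rn: "subspace (Rn n)"
  by (simp add: subspace_def mem_Rn lookup_add lookup_scaleR)

section \<open>Smooth fields are Lipschitz continuous on cubes\<close>

text \<open>
  Cubes serve as the bounded sets because they contain, with any two points, every point obtained
  by exchanging some coordinates between the two; norm balls do not.
\<close>

definition cube :: "nat \<Rightarrow> real \<Rightarrow> fvec set" where
  "cube n R = {x \<in> Rn n. \<forall>i. \<bar>Poly_Mapping.lookup x i\<bar> \<le> R}"

text \<open>
  The space of all finitely supported sequences is not locally compact, so compactness must come from
  the dimension: the cube in dimension \<open>n + 1\<close> is a continuous image of the product of the cube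
  in dimension \<open>n\<close> with an interval.
\<close>

lemma compact_cube: "compact (cube n R)"
proof (cases "R \<ge> 0")
  case False
  then have "cube n R = {}"
    by (auto simp: cube_def)
  then show ?thesis by simp
next
  case R: True
  show ?thesis
  proof (induction n)
    case 0
    have "cube 0 R \<subseteq> {0}"
      by (auto simp: cube_def Rn_def)
    then show ?case
      by (meson finite.emptyI finite_insert finite_subset finite_imp_compact)
  next
    case (Suc n)
    let ?g = "\<lambda>(x, t). x + t *\<^sub>R Poly_Mapping.single n (1::real)"
    have "cube (Suc n) R \<subseteq> ?g ` (cube n R \<times> {-R..R})"
    proof
      fix x assume x: "x \<in> cube (Suc n) R"
      let ?t = "Poly_Mapping.lookup x n"
      let ?x = "x - ?t *\<^sub>R Poly_Mapping.single n 1"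
      have "Poly_Mapping.lookup ?x i = (if i = n then 0 else Poly_Mapping.lookup x i)" for i
        by (simp add: lookup_minus lookup_scaleR lookup_single)
      then have "?x \<in> cube n R"
        using x R by (auto simp: cube_def mem_Rn)
      moreover have "?t \<in> {-R..R}"
        using x by (auto simp: cube_def abs_le_iff) (metis minus_le_iff)
      ultimately show "x \<in> ?g ` (cube n R \<times> {-R..R})"
        by (intro image_eqI[of _ _ "(?x, ?t)"]) auto
    qed
    moreover have "?g ` (cube n R \<times> {-R..R}) \<subseteq> cube (Suc n) R"
    proof clarsimp
      fix x t assume x: "x \<in> cube n R" and t: "- R \<le> t" "t \<le> R"
      have "Poly_Mapping.lookup (x + t *\<^sub>R Poly_Mapping.single n 1) i
          = (if i = n then t else Poly_Mapping.lookup x i)" for i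
        using x by (simp add: lookup_add lookup_scaleR lookup_single cube_def mem_Rn)
      then show "x + t *\<^sub>R Poly_Mapping.single n 1 \<in> cube (Suc n) R"
        using x t by (auto simp: cube_def mem_Rn)
    qed
    moreover have "compact (?g ` (cube n R \<times> {-R..R}))"
      by (intro compact_continuous_image compact_Times Suc compact_Icc)
         (auto simp: case_prod_unfold intro!: continuous_intros)
    ultimately show ?case by (metis subset_antisym)
  qed
qed

text \<open>The mean value inequality on a segment parallel to a coordinate axis.\<close>

lemma lipschitz_along_axis:
  fixes f :: "fvec \<Rightarrow> fvec"
  assumes g: "\<And>x. x \<in> Rn n \<Longrightarrow>
      ((\<lambda>t. f (x + t *\<^sub>R Poly_Mapping.single i 1)) has_vector_derivative g x) (at 0)"
    and i: "i < n"
    and x: "x \<in> cube n R" and xt: "x + t *\<^sub>R Poly_Mapping.single i 1 \<in> cube n R"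
    and B: "\<And>x. x \<in> cube n R \<Longrightarrow> norm (g x) \<le> B"
  shows "norm (f (x + t *\<^sub>R Poly_Mapping.single i 1) - f x) \<le> B * \<bar>t\<bar>"
proof -
  let ?e = "Poly_Mapping.single i (1::real)"
  have seg: "x + s *\<^sub>R ?e \<in> cube n R" if s: "s \<in> closed_segment 0 t" for s
  proof -
    have lk: "Poly_Mapping.lookup (x + s *\<^sub>R ?e) j
        = (if j = i then Poly_Mapping.lookup x i + s else Poly_Mapping.lookup x j)" for j s
      by (simp add: lookup_add lookup_scaleR lookup_single)
    have "\<bar>Poly_Mapping.lookup x i\<bar> \<le> R"
      using x by (simp add: cube_def)
    moreover have "\<bar>Poly_Mapping.lookup (x + t *\<^sub>R ?e) i\<bar> \<le> R"
      using xt unfolding cube_def by blast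
    ultimately have "\<bar>Poly_Mapping.lookup x i + s\<bar> \<le> R"
      using s by (auto simp: lk closed_segment_eq_real_ivl split: if_splits)
    then show ?thesis
      using x i by (auto simp: cube_def mem_Rn lk)
  qed
  have "norm (f (x + t *\<^sub>R ?e) - f (x + 0 *\<^sub>R ?e)) \<le> B * norm (t - 0)"
  proof (rule differentiable_bound[where S = "closed_segment 0 t"
        and f = "\<lambda>s. f (x + s *\<^sub>R ?e)" and f' = "\<lambda>s u. u *\<^sub>R g (x + s *\<^sub>R ?e)"])
    fix s assume s: "s \<in> closed_segment 0 t"
    let ?p = "x + s *\<^sub>R ?e"
    have "?p \<in> Rn n" using seg[OF s] by (simp add: cube_def)
    \<comment> \<open>The derivative is given at parameter 0 only; the base point is moved along the segment.\<close>
    then have d: "((\<lambda>u. f (?p + u *\<^sub>R ?e)) has_vector_derivative g ?p) (at (s - s))"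
      using g by simp
    have "((\<lambda>v. v - s) has_vector_derivative 1) (at s)"
      by (auto intro!: derivative_eq_intros)
    from vector_diff_chain_at[OF this d]
    have "((\<lambda>v. f (x + v *\<^sub>R ?e)) has_vector_derivative g ?p) (at s)"
      by (simp add: o_def algebra_simps)
    then show "((\<lambda>v. f (x + v *\<^sub>R ?e)) has_derivative (\<lambda>u. u *\<^sub>R g ?p))
        (at s within closed_segment 0 t)"
      unfolding has_vector_derivative_def by (rule has_derivative_at_withinI)
    show "onorm (\<lambda>u. u *\<^sub>R g ?p) \<le> B"
      using B[OF seg[OF s]]
      by (intro onorm_le) (simp add: mult.commute[of B] mult_left_mono)
  qed auto
  then show ?thesis by simp
qed

text \<open>
  Smoothness only provides partial derivatives. These are bounded on the compact cube, so one walks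
  from \<open>x\<close> to \<open>y\<close> by changing one coordinate at a time. The steps add up to \<open>norm (x - y)\<close>
  exactly, because the norm is the sum of the absolute values of the coordinates.
\<close>

lemma smooth_field_Lipschitz_on_cube:
  assumes "smooth_field n f"
  obtains L where "L \<ge> 0"
    "\<And>x y. x \<in> cube n R \<Longrightarrow> y \<in> cube n R \<Longrightarrow> norm (f x - f y) \<le> L * norm (x - y)"
proof -
  have "Ck_on_Rn n (Suc 0) f"
    using assms by (simp only: smooth_field_def)
  then have "\<forall>i<n. \<exists>g. (\<forall>x\<in>Rn n.
          ((\<lambda>t. f (x + t *\<^sub>R Poly_Mapping.single i 1)) has_vector_derivative g x) (at 0))
        \<and> continuous_on (Rn n) g"
    by simp
  then obtain g where g: "\<And>i x. i < n \<Longrightarrow> x \<in> Rn n \<Longrightarrow>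
          ((\<lambda>t. f (x + t *\<^sub>R Poly_Mapping.single i 1)) has_vector_derivative g i x) (at 0)"
    and cont: "\<And>i. i < n \<Longrightarrow> continuous_on (Rn n) (g i)"
    by metis
  have "bounded (\<Union>i<n. g i ` cube n R)"
  proof (rule bounded_UN)
    show "\<forall>i\<in>{..<n}. bounded (g i ` cube n R)"
    proof
      fix i assume "i \<in> {..<n}"
      then have "continuous_on (cube n R) (g i)"
        using cont[of i] by (auto simp: cube_def elim: continuous_on_subset)
      then show "bounded (g i ` cube n R)"
        by (intro compact_imp_bounded compact_continuous_image compact_cube)
    qed
  qed simp
  then obtain B where "B > 0"
    and B: "\<And>i x. i < n \<Longrightarrow> x \<in> cube n R \<Longrightarrow> norm (g i x) \<le> B"
    unfolding bounded_pos by blast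
  show ?thesis
  proof (rule that[of B])
    show "B \<ge> 0" using \<open>B > 0\<close> by simp
    fix x y assume x: "x \<in> cube n R" and y: "y \<in> cube n R"
    let ?d = "\<lambda>i. Poly_Mapping.lookup y i - Poly_Mapping.lookup x i"
    \<comment> \<open>The point with the first \<open>k\<close> coordinates from \<open>y\<close> and the others from \<open>x\<close>.\<close>
    define z where "z k = x + (\<Sum>i<k. ?d i *\<^sub>R Poly_Mapping.single i (1::real))" for k
    have lk: "Poly_Mapping.lookup (z k) j
        = (if j < k then Poly_Mapping.lookup y j else Poly_Mapping.lookup x j)" for j k
      by (induction k) (auto simp: z_def lookup_add lookup_scaleR lookup_single when_def)
    have zc: "z k \<in> cube n R" for k
      using x y by (auto simp: cube_def mem_Rn lk)
    have zS: "z (Suc k) = z k + ?d k *\<^sub>R Poly_Mapping.single k 1" for k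
      by (simp add: z_def add.assoc)
    have "norm (f (z k) - f x) \<le> B * (\<Sum>i<k. \<bar>?d i\<bar>)" if "k \<le> n" for k
      using that
    proof (induction k)
      case 0
      then show ?case by (simp add: z_def)
    next
      case (Suc k)
      have "norm (f (z (Suc k)) - f (z k)) \<le> B * \<bar>?d k\<bar>"
        unfolding zS using Suc.prems zc[of k] zc[of "Suc k"] zS B g
        by (intro lipschitz_along_axis[where g = "g k" and n = n and R = R]) auto
      moreover have "norm (f (z k) - f x) \<le> B * (\<Sum>i<k. \<bar>?d i\<bar>)"
        using Suc by simp
      ultimately show ?case
        using norm_triangle_ineq[of "f (z (Suc k)) - f (z k)" "f (z k) - f x"]
        by (simp add: distrib_left)
    qed
    from this[of n] have "norm (f (z n) - f x) \<le> B * (\<Sum>i<n. \<bar>?d i\<bar>)" by simp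
    moreover have "z n = y"
      using x y by (intro poly_mapping_eqI) (simp add: lk cube_def mem_Rn)
    moreover have "norm (y - x) = (\<Sum>i<n. \<bar>?d i\<bar>)"
      using x y by (subst norm_on_Rn[of _ n])
        (auto simp: lookup_minus cube_def intro: subspace_diff[OF subspace_Rn])
    ultimately show "norm (f x - f y) \<le> B * norm (x - y)"
      by (simp add: norm_minus_commute)
  qed
qed

lemma smooth_field_bounded_on_cube:
  assumes "smooth_field n f"
  obtains M where "M \<ge> 0" "\<And>x. x \<in> cube n R \<Longrightarrow> norm (f x) \<le> M"
proof -
  have "Ck_on_Rn n 0 f"
    using assms unfolding smooth_field_def by blast
  then have "continuous_on (cube n R) f"
    by (auto simp: cube_def elim: continuous_on_subset)
  then have "bounded (f ` cube n R)"
    by (intro compact_imp_bounded compact_continuous_image compact_cube)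
  then show thesis
    using that unfolding bounded_pos by (metis imageI less_imp_le)
qed

section \<open>Existence and uniqueness of the stages\<close>

text \<open>
  Finitely supported sequences do not form a complete space, so families of stages have to be
  confined to a complete set componentwise.
\<close>

lemma complete_vec_all:
  fixes S :: "'a::metric_space set"
  assumes "complete S"
  shows "complete {Y :: 'a^'s. \<forall>i. Y $ i \<in> S}"
  unfolding complete_def
proof (intro allI impI, elim conjE)
  fix X :: "nat \<Rightarrow> 'a^'s"
  assume X: "\<forall>n. X n \<in> {Y. \<forall>i. Y $ i \<in> S}" and "Cauchy X"
  have "\<exists>l\<in>S. (\<lambda>n. X n $ i) \<longlonglongrightarrow> l" for i
  proof -
    have "\<forall>n. X n $ i \<in> S" using X by simp
    with Cauchy_vec_nth[OF \<open>Cauchy X\<close>] show ?thesis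
      using assms[unfolded complete_def, rule_format, of "\<lambda>n. X n $ i"] by simp
  qed
  then obtain l where l: "\<And>i. l i \<in> S" "\<And>i. (\<lambda>n. X n $ i) \<longlonglongrightarrow> l i"
    by metis
  have "X \<longlonglongrightarrow> (\<chi> i. l i)"
    using l(2) by (intro vec_tendstoI) simp
  then show "\<exists>L\<in>{Y. \<forall>i. Y $ i \<in> S}. X \<longlonglongrightarrow> L"
    using l(1) by (intro bexI[of _ "\<chi> i. l i"]) auto
qed

lemma Rn_cball_subset_cube:
  assumes "y0 \<in> cube n R" "x \<in> Rn n" "dist x y0 \<le> r"
  shows "x \<in> cube n (R + r)"
proof -
  have "\<bar>Poly_Mapping.lookup x i\<bar> \<le> R + r" for i
  proof -
    have "\<bar>Poly_Mapping.lookup (x - y0) i\<bar> \<le> r"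
      using abs_lookup_le_norm[of "x - y0" i] assms(3) by (simp add: dist_norm)
    moreover have "\<bar>Poly_Mapping.lookup y0 i\<bar> \<le> R" using assms(1) by (simp add: cube_def)
    ultimately show ?thesis by (simp add: lookup_minus)
  qed
  then show ?thesis using assms by (simp add: cube_def)
qed

lemma norm_scaled_sum_le:
  fixes v :: "'s::finite \<Rightarrow> 'a::real_normed_vector"
  assumes "\<And>j. norm (v j) \<le> M"
  shows "norm (h *\<^sub>R (\<Sum>j\<in>UNIV. w j *\<^sub>R v j)) \<le> \<bar>h\<bar> * (\<Sum>j\<in>UNIV. \<bar>w j\<bar>) * M"
proof -
  have "norm (\<Sum>j\<in>UNIV. w j *\<^sub>R v j) \<le> (\<Sum>j\<in>UNIV. \<bar>w j\<bar> * M)"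
    using assms by (intro order_trans[OF norm_sum] sum_mono) (simp add: mult_left_mono)
  then show ?thesis
    by (simp add: sum_distrib_right mult.assoc mult_left_mono)
qed

lemma eventually_abs_times_less:
  fixes C e :: real
  assumes "e > 0"
  shows "\<forall>\<^sub>F h in nhds 0. \<bar>h\<bar> * C < e"
proof -
  have "((\<lambda>h. \<bar>h\<bar> * C) \<longlongrightarrow> \<bar>0\<bar> * C) (nhds 0)"
    by (intro tendsto_intros filterlim_ident)
  then show ?thesis using assms by (auto dest: order_tendstoD(2))
qed

text \<open>
  The right-hand sides of the stage equations define a map \<open>F\<close> on families of stages within distance
  \<open>r\<close> of \<open>y0\<close>. For small \<open>\<bar>h\<bar>\<close> it contracts by \<open>1/2\<close>. It also sends the closed balls into the open
  ones, hence the unique fixed point in the closed balls is the unique solution within distance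
  less than \<open>r\<close>. The smallness of \<open>\<bar>h\<bar>\<close> depends only on \<open>A\<close>, \<open>r\<close> and on bounds for \<open>f\<close>
  in a cube that contains all points of \<open>Rn n\<close> in question, which makes the bound on \<open>\<bar>h\<bar>\<close> uniform.
\<close>

lemma eventually_unique_stages:
  fixes A :: "real^'s^'s"
  assumes f: "smooth_field n f" and r: "r > 0"
  shows "\<forall>\<^sub>F h in nhds 0. \<forall>y0\<in>cube n R.
           \<exists>!Y. rk_stages A n f h y0 Y \<and> (\<forall>i. dist (Y i) y0 < r)"
proof -
  let ?C = "cube n (R + r)"
  obtain L where L0: "L \<ge> 0"
    and L: "\<And>x y. x \<in> ?C \<Longrightarrow> y \<in> ?C \<Longrightarrow> norm (f x - f y) \<le> L * norm (x - y)"
    using smooth_field_Lipschitz_on_cube[OF f, of "R + r"] by metis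
  obtain M where M0: "M \<ge> 0" and M: "\<And>x. x \<in> ?C \<Longrightarrow> norm (f x) \<le> M"
    using smooth_field_bounded_on_cube[OF f, of "R + r"] by metis
  define a where "a = (\<Sum>i\<in>UNIV. \<Sum>j\<in>UNIV. \<bar>A $ i $ j\<bar>)"
  have row: "(\<Sum>j\<in>UNIV. \<bar>A $ i $ j\<bar>) \<le> a" for i
    unfolding a_def by (rule member_le_sum) (auto intro: sum_nonneg)
  have "\<forall>\<^sub>F h in nhds 0. \<bar>h\<bar> * (a * M) < r \<and> \<bar>h\<bar> * (a * L) < 1/2"
    using r by (intro eventually_conj eventually_abs_times_less) auto
  then show ?thesis
  proof eventually_elim
    case (elim h)
    show ?case
    proof
      fix y0 assume y0: "y0 \<in> cube n R"
      define F where "F Y = (\<chi> i. y0 + h *\<^sub>R (\<Sum>j\<in>UNIV. A $ i $ j *\<^sub>R f (Y $ j)))"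
        for Y :: "fvec^'s"
      define S where "S = ?C \<inter> cball y0 r"
      have S: "x \<in> S \<longleftrightarrow> x \<in> Rn n \<and> dist x y0 \<le> r" for x
        using Rn_cball_subset_cube[OF y0] by (auto simp: S_def cube_def dist_commute)
      let ?T = "{Y :: fvec^'s. \<forall>i. Y $ i \<in> S}"
      have fRn: "f x \<in> Rn n" if "x \<in> Rn n" for x
        using f that by (auto simp: smooth_field_def)
      have inRn: "F Y $ i \<in> Rn n" if "\<And>j. Y $ j \<in> Rn n" for Y i
        using y0 that fRn unfolding F_def
        by (auto simp: cube_def intro!: subspace_add subspace_scale subspace_sum subspace_Rn)
      have near: "dist (F Y $ i) y0 < r" if "Y \<in> ?T" for Y i
      proof -
        have "norm (f (Y $ j)) \<le> M" for j
          using that M by (simp add: S_def)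
        from norm_scaled_sum_le[OF this]
        have "dist (F Y $ i) y0 \<le> \<bar>h\<bar> * (\<Sum>j\<in>UNIV. \<bar>A $ i $ j\<bar>) * M"
          by (simp add: F_def dist_norm)
        also have "\<dots> \<le> \<bar>h\<bar> * a * M"
          using row M0 by (intro mult_right_mono mult_left_mono) auto
        finally show ?thesis using elim by (simp add: mult.assoc)
      qed
      have contr: "dist (F Y) (F Z) \<le> 1/2 * dist Y Z" if "Y \<in> ?T" "Z \<in> ?T" for Y Z
      proof -
        have comp: "norm (f (Y $ j) - f (Z $ j)) \<le> L * norm (Y - Z)" for j
        proof -
          have "norm (f (Y $ j) - f (Z $ j)) \<le> L * norm ((Y - Z) $ j)"
            using that L by (simp add: S_def)
          also have "\<dots> \<le> L * norm (Y - Z)"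
            using L0 by (intro mult_left_mono Finite_Cartesian_Product.norm_nth_le)
          finally show ?thesis .
        qed
        have "norm (F Y - F Z) \<le> (\<Sum>i\<in>UNIV. norm ((F Y - F Z) $ i))"
          unfolding norm_vec_def by (rule L2_set_le_sum) simp
        also have "\<dots> \<le> (\<Sum>i\<in>UNIV. \<bar>h\<bar> * (\<Sum>j\<in>UNIV. \<bar>A $ i $ j\<bar>) * (L * norm (Y - Z)))"
        proof (rule sum_mono)
          fix i
          have "(F Y - F Z) $ i
              = h *\<^sub>R (\<Sum>j\<in>UNIV. A $ i $ j *\<^sub>R (f (Y $ j) - f (Z $ j)))"
            by (simp add: F_def scaleR_diff_right sum_subtractf)
          then show "norm ((F Y - F Z) $ i)
              \<le> \<bar>h\<bar> * (\<Sum>j\<in>UNIV. \<bar>A $ i $ j\<bar>) * (L * norm (Y - Z))"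
            using norm_scaled_sum_le[OF comp] by simp
        qed
        also have "\<dots> = \<bar>h\<bar> * (a * L) * norm (Y - Z)"
          by (simp add: a_def sum_distrib_left sum_distrib_right mult.assoc)
        also have "\<dots> \<le> 1/2 * norm (Y - Z)"
          using elim by (intro mult_right_mono) auto
        finally show ?thesis by (simp add: dist_norm)
      qed
      have "complete S"
        unfolding S_def
        by (intro compact_imp_complete compact_Int_closed compact_cube closed_cball)
      then have "complete ?T" by (rule complete_vec_all)
      moreover have "(\<chi> i. y0) \<in> ?T"
        using y0 r by (simp add: S cube_def)
      then have "?T \<noteq> {}" by blast
      moreover have "F ` ?T \<subseteq> ?T"
        using inRn near by (auto simp: S less_imp_le)
      ultimately have "\<exists>!Y\<in>?T. F Y = Y"
        using contr by (intro Banach_fix[where c = "1/2"]) auto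
      then obtain Y where Y: "Y \<in> ?T" "F Y = Y"
        and uniq: "\<And>Z. Z \<in> ?T \<Longrightarrow> F Z = Z \<Longrightarrow> Z = Y"
        by blast
      show "\<exists>!Y. rk_stages A n f h y0 Y \<and> (\<forall>i. dist (Y i) y0 < r)"
      proof (rule ex1I[of _ "\<lambda>i. Y $ i"])
        have "Y $ i \<in> Rn n"
          and "Y $ i = y0 + h *\<^sub>R (\<Sum>j\<in>UNIV. A $ i $ j *\<^sub>R f (Y $ j))"
          and "dist (Y $ i) y0 < r" for i
          using arg_cong[OF Y(2), of "\<lambda>v. v $ i"] near[OF Y(1), of i] Y
          by (simp_all add: F_def S)
        then show "rk_stages A n f h y0 (\<lambda>i. Y $ i) \<and> (\<forall>i. dist (Y $ i) y0 < r)"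
          unfolding rk_stages_def by blast
      next
        fix Z assume Z: "rk_stages A n f h y0 Z \<and> (\<forall>i. dist (Z i) y0 < r)"
        have "(\<chi> i. Z i) = Y"
        proof (rule uniq)
          have "Z i \<in> Rn n" "dist (Z i) y0 < r" for i
            using Z unfolding rk_stages_def by blast+
          then show "(\<chi> i. Z i) \<in> ?T"
            by (simp add: S less_imp_le)
          have "y0 + h *\<^sub>R (\<Sum>j\<in>UNIV. A $ i $ j *\<^sub>R f (Z j)) = Z i" for i
            using Z unfolding rk_stages_def by metis
          then show "F (\<chi> i. Z i) = (\<chi> i. Z i)"
            by (simp add: F_def vec_eq_iff)
        qed
        then show "Z = (\<lambda>i. Y $ i)" by auto
      qed
    qed
  qed
qed

lemma rk_map_eqI:
  assumes "\<exists>!Y. rk_stages A n f h y0 Y \<and> (\<forall>i. dist (Y i) y0 < r)"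
    and "rk_stages A n f h y0 Y" "\<And>i. dist (Y i) y0 < r"
  shows "rk_map A b n f r h y0 = Some (y0 + h *\<^sub>R (\<Sum>i\<in>UNIV. b $ i *\<^sub>R f (Y i)))"
proof -
  have "(THE Y. rk_stages A n f h y0 Y \<and> (\<forall>i. dist (Y i) y0 < r)) = Y"
    using assms by (intro the1_equality) auto
  then show ?thesis using assms(1) by (simp add: rk_map_def)
qed

lemma rk_map_SomeD:
  assumes "rk_map A b n f r h y0 = Some y1"
  obtains Y where "rk_stages A n f h y0 Y"
    "y1 = y0 + h *\<^sub>R (\<Sum>i\<in>UNIV. b $ i *\<^sub>R f (Y i))"
proof -
  let ?near = "\<lambda>Y. rk_stages A n f h y0 Y \<and> (\<forall>i. dist (Y i) y0 < r)"
  have ex: "\<exists>!Y. ?near Y"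
    using assms by (auto simp: rk_map_def Let_def split: if_splits)
  show thesis
    using that[of "THE Y. ?near Y"] theI'[OF ex] assms ex by (simp add: rk_map_def)
qed

section \<open>A method of order p has a quadrature formula of order p\<close>

text \<open>
  This family of functions is closed under partial derivatives, which lets the induction on
  the degree of differentiability go through. The right-hand sides of the test equations below
  belong to it.
\<close>

lemma Ck_affine_power:
  "Ck_on_Rn n k (\<lambda>x. u + Poly_Mapping.lookup x j ^ m *\<^sub>R v)"
proof (induction k arbitrary: u v m)
  case 0
  show ?case
    by (auto intro!: continuous_intros bounded_linear.continuous_on[OF bounded_linear_lookup])
next
  case (Suc k)
  have cont: "continuous_on (Rn n) (\<lambda>x. u + Poly_Mapping.lookup x j ^ m *\<^sub>R v)"
    by (auto intro!: continuous_intros bounded_linear.continuous_on[OF bounded_linear_lookup])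
  have "\<exists>g. (\<forall>x\<in>Rn n.
          ((\<lambda>t. u + Poly_Mapping.lookup (x + t *\<^sub>R Poly_Mapping.single i 1) j ^ m *\<^sub>R v)
             has_vector_derivative g x) (at 0)) \<and> Ck_on_Rn n k g" for i
  proof (cases "i = j")
    case True
    have "((\<lambda>t. u + (Poly_Mapping.lookup x j + t) ^ m *\<^sub>R v) has_vector_derivative
        0 + Poly_Mapping.lookup x j ^ (m - 1) *\<^sub>R (real m *\<^sub>R v)) (at 0)" for x
      by (auto intro!: derivative_eq_intros simp: mult.commute)
    then show ?thesis
      using Suc[of 0 "m - 1" "real m *\<^sub>R v"] True
      by (intro exI[of _ "\<lambda>x. 0 + Poly_Mapping.lookup x j ^ (m - 1) *\<^sub>R (real m *\<^sub>R v)"])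
         (simp add: lookup_add lookup_scaleR lookup_single)
  next
    case False
    then show ?thesis
      using Suc[of 0 0 0]
      by (intro exI[of _ "\<lambda>x. 0"]) (simp add: lookup_add lookup_scaleR lookup_single when_def)
  qed
  then show ?case using cont by simp
qed

text \<open>
  Only the test equations \<open>x' = 1, y' = x\<^sup>m\<close> from the origin are needed, whose solution is
  \<open>(t, t\<^sup>k/k)\<close> with \<open>k = m + 1\<close>. In the first coordinate, stage \<open>i\<close> is \<open>h c\<^sub>i\<close> with \<open>c = A 1\<close>, so
  the second coordinate of the numerical solution is \<open>h\<^sup>k \<Sum> b\<^sub>i c\<^sub>i\<^sup>m\<close>. It differs from the exact value
  by \<open>h\<^sup>k\<close> times the quadrature defect, which cannot be \<open>O(h\<^bsup>p+1\<^esup>)\<close> for \<open>k \<le> p\<close> unless the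
  defect vanishes.
\<close>

lemma order_imp_quadrature_order:
  fixes A :: "real^'s^'s"
  assumes ord: "order_at_least (rk_map A b) p"
  shows "quadrature_order_at_least (A *v 1) b p"
  unfolding quadrature_order_at_least_def
proof
  fix k assume k: "k \<in> {1..p}"
  define m where "m = k - 1"
  have km: "k = Suc m" using k by (simp add: m_def)
  let ?lk = "Poly_Mapping.lookup :: fvec \<Rightarrow> nat \<Rightarrow> real"
  let ?e = "\<lambda>i. Poly_Mapping.single (i::nat) (1::real)"
  let ?c = "A *v 1"
  define q where "q = (\<Sum>i\<in>UNIV. b $ i * ?c $ i ^ m) - 1 / real k"
  define f where "f x = ?e 0 + ?lk x 0 ^ m *\<^sub>R ?e 1" for x
  define y where "y t = t *\<^sub>R ?e 0 + (t ^ k / real k) *\<^sub>R ?e 1" for t :: real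
  have e: "?e 0 \<in> Rn 2" "?e 1 \<in> Rn 2"
    by (rule single_mem_Rn, simp)+
  have "smooth_field 2 f"
    unfolding smooth_field_def f_def
    using e by (auto simp: Ck_affine_power intro!: subspace_add subspace_scale subspace_Rn)
  moreover have "local_solution 2 f 0 y"
    unfolding local_solution_def
  proof (intro conjI always_eventually allI)
    show "y 0 = 0" by (simp add: y_def km)
    fix t
    show "y t \<in> Rn 2"
      unfolding y_def using e by (intro subspace_add subspace_scale subspace_Rn)
    have "?lk (y t) 0 = t"
      by (simp add: y_def lookup_add lookup_scaleR lookup_single lookup_one)
    moreover have "(y has_vector_derivative (?e 0 + t ^ m *\<^sub>R ?e 1)) (at t)"
      unfolding y_def using k by (auto intro!: derivative_eq_intros simp: m_def)
    ultimately show "(y has_vector_derivative f (y t)) (at t)"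
      by (simp add: f_def)
  qed
  moreover have "0 \<in> Rn 2" by (simp add: mem_Rn)
  ultimately obtain C where C: "\<forall>\<^sub>F h in nhds 0. \<exists>y1. rk_map A b 2 f 1 h 0 = Some y1
      \<and> norm (y1 - y h) \<le> C * \<bar>h\<bar> ^ (p + 1)"
    using ord zero_less_one unfolding order_at_least_def by blast
  have "\<forall>\<^sub>F h in nhds 0. \<bar>h\<bar> ^ k * \<bar>q\<bar> \<le> C * \<bar>h\<bar> ^ (p + 1)"
    using C
  proof eventually_elim
    case (elim h)
    then obtain y1 where y1: "rk_map A b 2 f 1 h 0 = Some y1"
      and err: "norm (y1 - y h) \<le> C * \<bar>h\<bar> ^ (p + 1)" by blast
    obtain Y where Y: "rk_stages A 2 f h 0 Y"
      and y1: "y1 = 0 + h *\<^sub>R (\<Sum>i\<in>UNIV. b $ i *\<^sub>R f (Y i))"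
      using rk_map_SomeD[OF y1] .
    have lksum: "?lk (\<Sum>i\<in>I. g i) j = (\<Sum>i\<in>I. ?lk (g i) j)" for I :: "'s set" and g j
      by (rule bounded_linear.linear[OF bounded_linear_lookup, THEN linear_sum])
    have f0: "?lk (f x) 0 = 1" and f1: "?lk (f x) 1 = ?lk x 0 ^ m" for x
      by (simp_all add: f_def lookup_add lookup_scaleR lookup_single lookup_one)
    have Y0: "?lk (Y i) 0 = h * ?c $ i" for i
    proof -
      have "Y i = 0 + h *\<^sub>R (\<Sum>j\<in>UNIV. A $ i $ j *\<^sub>R f (Y j))"
        using Y unfolding rk_stages_def by blast
      then have "?lk (Y i) 0 = ?lk (0 + h *\<^sub>R (\<Sum>j\<in>UNIV. A $ i $ j *\<^sub>R f (Y j))) 0"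
        by (rule arg_cong)
      then show ?thesis
        by (simp add: lookup_scaleR lksum f0 matrix_vector_mult_def)
    qed
    have "?lk y1 1 = h ^ k * (\<Sum>i\<in>UNIV. b $ i * ?c $ i ^ m)"
      unfolding y1 km
      by (simp add: lookup_scaleR lksum f1 [unfolded One_nat_def] Y0 power_mult_distrib sum_distrib_left mult_ac)
    moreover have "?lk (y h) 1 = h ^ k / real k"
      by (simp add: y_def lookup_add lookup_scaleR lookup_single lookup_one)
    ultimately have "?lk (y1 - y h) 1 = h ^ k * q"
      by (simp add: q_def lookup_minus right_diff_distrib)
    then show "\<bar>h\<bar> ^ k * \<bar>q\<bar> \<le> C * \<bar>h\<bar> ^ (p + 1)"
      using abs_lookup_le_norm[of "y1 - y h" 1] err by (simp add: abs_mult power_abs)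
  qed
  then have "\<forall>\<^sub>F h in at_right 0. \<bar>h\<bar> ^ k * \<bar>q\<bar> \<le> C * \<bar>h\<bar> ^ (p + 1)"
    by (auto simp: eventually_at_filter elim: eventually_mono)
  then have "\<forall>\<^sub>F h in at_right 0. \<bar>q\<bar> \<le> C * h ^ Suc (p - k)"
    using eventually_at_right_less[of 0]
  proof eventually_elim
    case (elim h)
    have "h ^ (p + 1) = h ^ k * h ^ Suc (p - k)"
      using k by (simp flip: power_add)
    then have "h ^ k * \<bar>q\<bar> \<le> h ^ k * (C * h ^ Suc (p - k))"
      using elim by (simp add: mult_ac)
    then show ?case
      using elim(2) by (simp only: mult_le_cancel_left_pos zero_less_power)
  qed
  moreover have "((\<lambda>h. C * h ^ Suc (p - k)) \<longlongrightarrow> C * 0 ^ Suc (p - k)) (at_right 0)"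
    by (intro tendsto_intros)
  ultimately have "\<bar>q\<bar> \<le> 0"
    by (intro tendsto_lowerbound[where F = "at_right (0::real)"]) auto
  then show "(\<Sum>i\<in>UNIV. b $ i * ?c $ i ^ (k - 1)) = 1 / real k"
    by (simp add: q_def m_def)
qed

section \<open>The weights of the two halves\<close>

text \<open>
  The moments determine the sum of \<open>d\<^sub>j p(c\<^sub>j)\<close> for each polynomial \<open>p\<close> of degree below \<open>s\<close>; the
  Lagrange polynomial that vanishes at all nodes except \<open>c\<^sub>i\<close> isolates \<open>d\<^sub>i\<close>.
\<close>

lemma weights_eq_zero_if_moments_vanish:
  fixes d c :: "real^'s"
  assumes inj: "inj (\<lambda>i. c $ i)"
    and mom: "\<And>k. k < CARD('s) \<Longrightarrow> (\<Sum>i\<in>UNIV. d $ i * c $ i ^ k) = 0"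
  shows "d = 0"
proof -
  have "d $ i = 0" for i
  proof -
    define p where "p = (\<Prod>j\<in>UNIV - {i}. [:- c $ j, 1:])"
    have deg: "degree p < CARD('s)"
    proof -
      have "degree p \<le> (\<Sum>j\<in>UNIV - {i}. degree [:- c $ j, 1:])"
        unfolding p_def by (rule order_trans[OF degree_prod_sum_le]) auto
      then show ?thesis by (simp add: card_Diff_singleton) (metis diff_less le_less_trans zero_less_card_finite zero_less_one One_nat_def)
    qed
    have p: "poly p (c $ j) = 0 \<longleftrightarrow> j \<noteq> i" for j
      using inj by (auto simp: p_def poly_prod inj_def)
    have "(\<Sum>j\<in>UNIV. d $ j * poly p (c $ j))
        = (\<Sum>j\<in>UNIV. \<Sum>k\<le>degree p. coeff p k * (d $ j * c $ j ^ k))"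
      by (simp add: poly_altdef sum_distrib_left mult_ac)
    also have "\<dots> = (\<Sum>k\<le>degree p. coeff p k * (\<Sum>j\<in>UNIV. d $ j * c $ j ^ k))"
      by (subst sum.swap) (simp add: sum_distrib_left)
    also have "\<dots> = 0"
      using mom deg by (intro sum.neutral) auto
    finally have "(\<Sum>j\<in>UNIV. d $ j * poly p (c $ j)) = 0" .
    moreover have "(\<Sum>j\<in>UNIV. d $ j * poly p (c $ j))
        = d $ i * poly p (c $ i) + (\<Sum>j\<in>UNIV - {i}. d $ j * poly p (c $ j))"
      by (rule sum.remove) auto
    moreover have "(\<Sum>j\<in>UNIV - {i}. d $ j * poly p (c $ j)) = 0"
      by (rule sum.neutral) (simp add: p)
    ultimately have "d $ i * poly p (c $ i) = 0"
      by linarith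
    then show ?thesis by (simp add: p)
  qed
  then show ?thesis by (simp add: vec_eq_iff)
qed

text \<open>
  The value is the integral of \<open>x\<^sup>m\<close> over \<open>[1,2]\<close>, to which the formula is translated. The binomial
  theorem reduces the claim to the moments on \<open>[0,1]\<close>.
\<close>

lemma quadrature_shifted_moment:
  fixes \<gamma> \<beta> :: "real^'s"
  assumes "quadrature_order_at_least \<gamma> \<beta> p" "m < p"
  shows "(\<Sum>i\<in>UNIV. \<beta> $ i * (\<gamma> $ i + 1) ^ m) = (2 ^ Suc m - 1) / real (Suc m)"
proof -
  have mom: "(\<Sum>i\<in>UNIV. \<beta> $ i * \<gamma> $ i ^ j) = 1 / real (Suc j)" if "j \<le> m" for j
    using assms that by (auto simp: quadrature_order_at_least_def dest: bspec[of _ _ "Suc j"])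
  have "(\<Sum>i\<in>UNIV. \<beta> $ i * (\<gamma> $ i + 1) ^ m)
      = (\<Sum>i\<in>UNIV. \<Sum>j\<le>m. real (m choose j) * (\<beta> $ i * \<gamma> $ i ^ j))"
    by (simp add: binomial_ring sum_distrib_left mult_ac)
  also have "\<dots> = (\<Sum>j\<le>m. real (m choose j) * (\<Sum>i\<in>UNIV. \<beta> $ i * \<gamma> $ i ^ j))"
    by (subst sum.swap) (simp add: sum_distrib_left)
  also have "\<dots> = (\<Sum>j\<le>m. real (Suc m choose Suc j) / real (Suc m))"
  proof (rule sum.cong[OF refl])
    fix j assume "j \<in> {..m}"
    have "real (Suc j) * real (Suc m choose Suc j) = real (Suc m) * real (m choose j)"
      by (metis Suc_times_binomial of_nat_mult)
    then have "real (m choose j) = real (Suc j) * real (Suc m choose Suc j) / real (Suc m)"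
      by (simp add: field_simps del: of_nat_Suc binomial_Suc_Suc)
    then show "real (m choose j) * (\<Sum>i\<in>UNIV. \<beta> $ i * \<gamma> $ i ^ j)
        = real (Suc m choose Suc j) / real (Suc m)"
      using mom[of j] \<open>j \<in> {..m}\<close> by (simp del: of_nat_Suc binomial_Suc_Suc)
  qed
  also have "\<dots> = ((\<Sum>j\<le>Suc m. real (Suc m choose j)) - 1) / real (Suc m)"
    by (simp add: sum_divide_distrib[symmetric] sum.atMost_Suc_shift del: sum.atMost_Suc binomial_Suc_Suc)
  also have "(\<Sum>j\<le>Suc m. real (Suc m choose j)) = 2 ^ Suc m"
    by (metis choose_row_sum of_nat_sum of_nat_power of_nat_numeral)
  finally show ?thesis .
qed

text \<open>
  In the coordinate \<open>u = 2x\<close>, the weights \<open>b1\<close> integrate over \<open>[0,1]\<close> and the weights \<open>b2\<close> over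
  \<open>[1,2]\<close>, both at the nodes \<open>2c\<close>; together they integrate over \<open>[0,2]\<close>, as \<open>2b\<close> does.
\<close>

lemma split_quadrature_weights:
  fixes b b1 b2 c :: "real^'s"
  assumes inj: "inj (\<lambda>i. c $ i)"
    and q: "quadrature_order_at_least c b CARD('s)"
    and q1: "quadrature_order_at_least (2 *\<^sub>R c) b1 CARD('s)"
    and q2: "quadrature_order_at_least (2 *\<^sub>R c - 1) b2 CARD('s)"
  shows "b1 + b2 = 2 *\<^sub>R b"
proof -
  have "b1 + b2 - 2 *\<^sub>R b = 0"
  proof (rule weights_eq_zero_if_moments_vanish[OF inj])
    fix m assume m: "m < CARD('s)"
    have mb: "(\<Sum>i\<in>UNIV. b $ i * c $ i ^ m) = 1 / real (Suc m)"
      using q m by (auto simp: quadrature_order_at_least_def dest: bspec[of _ _ "Suc m"])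
    have "(\<Sum>i\<in>UNIV. b1 $ i * (2 * c $ i) ^ m) = 1 / real (Suc m)"
      using q1 m by (auto simp: quadrature_order_at_least_def dest: bspec[of _ _ "Suc m"])
    then have m1: "2 ^ m * (\<Sum>i\<in>UNIV. b1 $ i * c $ i ^ m) = 1 / real (Suc m)"
      by (simp add: power_mult_distrib sum_distrib_left mult_ac)
    have "(\<Sum>i\<in>UNIV. b2 $ i * (2 * c $ i) ^ m) = (2 ^ Suc m - 1) / real (Suc m)"
      using quadrature_shifted_moment[OF q2 m] by simp
    then have m2: "2 ^ m * (\<Sum>i\<in>UNIV. b2 $ i * c $ i ^ m) = (2 ^ Suc m - 1) / real (Suc m)"
      by (simp add: power_mult_distrib sum_distrib_left mult_ac)
    have "(\<Sum>i\<in>UNIV. (b1 + b2 - 2 *\<^sub>R b) $ i * c $ i ^ m)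
        = (\<Sum>i\<in>UNIV. b1 $ i * c $ i ^ m) + (\<Sum>i\<in>UNIV. b2 $ i * c $ i ^ m)
          - 2 * (\<Sum>i\<in>UNIV. b $ i * c $ i ^ m)"
      by (simp add: algebra_simps sum.distrib sum_subtractf sum_distrib_left)
    then have "2 ^ m * (\<Sum>i\<in>UNIV. (b1 + b2 - 2 *\<^sub>R b) $ i * c $ i ^ m)
        = 2 ^ m * (\<Sum>i\<in>UNIV. b1 $ i * c $ i ^ m) + 2 ^ m * (\<Sum>i\<in>UNIV. b2 $ i * c $ i ^ m)
          - 2 ^ Suc m * (\<Sum>i\<in>UNIV. b $ i * c $ i ^ m)"
      by (simp only: distrib_left right_diff_distrib power_Suc mult_ac)
    also have "\<dots> = 0"
      unfolding mb m1 m2 by (simp add: diff_divide_distrib)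
    finally have "2 ^ m * (\<Sum>i\<in>UNIV. (b1 + b2 - 2 *\<^sub>R b) $ i * c $ i ^ m) = 0" .
    then show "(\<Sum>i\<in>UNIV. (b1 + b2 - 2 *\<^sub>R b) $ i * c $ i ^ m) = 0"
      by simp
  qed
  then show ?thesis by simp
qed

section \<open>The common stages of the three methods\<close>

lemma rk_stages_rescale: "rk_stages (2 *\<^sub>R A) n f (h / 2) = rk_stages A n f h"
  by (simp add: fun_eq_iff rk_stages_def scaleR_sum_right)

text \<open>
  Subtracting \<open>b1\<close> from each row of the matrix takes off in every stage exactly the increment that
  the first half step has added to \<open>y0\<close>.
\<close>

lemma rk_stages_second_half:
  fixes A :: "real^'s^'s" and b1 :: "real^'s"
  assumes "rk_stages A n f h y0 Y"
  shows "rk_stages (2 *\<^sub>R A - (\<chi> i j. 1 $ i * b1 $ j)) n f (h / 2)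
           (y0 + (h / 2) *\<^sub>R (\<Sum>i\<in>UNIV. b1 $ i *\<^sub>R f (Y i))) Y"
proof -
  have "y0 + h *\<^sub>R (\<Sum>j\<in>UNIV. A $ i $ j *\<^sub>R f (Y j))
      = y0 + (h / 2) *\<^sub>R (\<Sum>j\<in>UNIV. b1 $ j *\<^sub>R f (Y j))
        + (h / 2) *\<^sub>R (\<Sum>j\<in>UNIV. (2 *\<^sub>R A - (\<chi> i j. 1 $ i * b1 $ j)) $ i $ j *\<^sub>R f (Y j))" for i
    by (simp add: scaleR_diff_left sum_subtractf scaleR_diff_right scaleR_sum_right)
  moreover have "Y i \<in> Rn n" "Y i = y0 + h *\<^sub>R (\<Sum>j\<in>UNIV. A $ i $ j *\<^sub>R f (Y j))" for i
    using assms unfolding rk_stages_def by blast+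
  ultimately show ?thesis
    unfolding rk_stages_def by (metis (no_types))
qed

text \<open>
  The stage equations having a common solution, it remains to see that this is the solution
  selected by each of the three one-step maps. As \<open>\<Psi>\<close> measures distances from the midpoint \<open>yh\<close>
  instead of \<open>y0\<close>, \<open>Y\<close> is taken within \<open>r/2\<close> of \<open>y0\<close> and \<open>h\<close> so small that \<open>yh\<close> is also within
  \<open>r/2\<close> of \<open>y0\<close>. The midpoints may leave the cube that contains \<open>K\<close>, but by less than \<open>1\<close>, hence the
  larger cube for the uniqueness of the stages of \<open>\<Psi>\<close>.
\<close>

theorem theorem2:
  fixes A A1 A2 :: "real^'s^'s" and b b1 b2 c c1 c2 :: "real^'s"
  assumes "c = A *v 1"
    and "inj (\<lambda>i. c $ i)"
    and "order_at_least (rk_map A b) CARD('s)"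
    and "A1 = 2 *\<^sub>R A"
    and "c1 = 2 *\<^sub>R c"
    and "quadrature_order_at_least c1 b1 CARD('s)"
    and "A2 = 2 *\<^sub>R A - (\<chi> i j. 1 $ i * b1 $ j)"
    and "c2 = 2 *\<^sub>R c - 1"
    and "quadrature_order_at_least c2 b2 CARD('s)"
  shows "one_step_equivalent (half_step_comp (rk_map A2 b2) (rk_map A1 b1)) (rk_map A b)"
  unfolding one_step_equivalent_def
proof (intro allI impI)
  have "b1 + b2 = 2 *\<^sub>R b"
    using assms order_imp_quadrature_order[OF assms(3)] by (intro split_quadrature_weights[of c]) auto
  then have bsum: "b1 $ i + b2 $ i = 2 * b $ i" for i
    by (metis vector_add_component vector_scaleR_component real_scaleR_def)
  fix n f K r
  assume f: "smooth_field n f" and K: "compact K" "K \<subseteq> Rn n" and r: "(r::real) > 0"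
  obtain R where R: "\<And>x. x \<in> K \<Longrightarrow> norm x \<le> R"
    using compact_imp_bounded[OF K(1)] unfolding bounded_iff by blast
  have KR: "K \<subseteq> cube n R"
    using K(2) R abs_lookup_le_norm by (fastforce simp: cube_def intro: order_trans)
  obtain M where M: "\<And>x. x \<in> cube n (R + r) \<Longrightarrow> norm (f x) \<le> M"
    using smooth_field_bounded_on_cube[OF f, of "R + r"] by metis
  have "((\<lambda>h::real. h / 2) \<longlongrightarrow> 0 / 2) (nhds 0)"
    by (intro tendsto_intros filterlim_ident) auto
  then have half: "filterlim (\<lambda>h::real. h / 2) (nhds 0) (nhds 0)" by simp
  have "\<forall>\<^sub>F h in nhds 0. \<bar>h\<bar> * ((\<Sum>j\<in>UNIV. \<bar>b1 $ j\<bar>) * M) < min 1 (r / 2)"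
    using r by (intro eventually_abs_times_less) auto
  note small = eventually_compose_filterlim[OF this half]
  note first = eventually_unique_stages[OF f r, of R A]
  have "r / 2 > 0" using r by simp
  note closer = eventually_unique_stages[OF f this, of R A]
  note second = eventually_compose_filterlim[OF eventually_unique_stages[OF f r, of "R + 1" A2] half]
  from small first closer second
  show "\<forall>\<^sub>F h in nhds 0. \<forall>y0\<in>K. \<exists>y1. half_step_comp (rk_map A2 b2) (rk_map A1 b1) n f r h y0 = Some y1
      \<and> rk_map A b n f r h y0 = Some y1"
  proof eventually_elim
    case (elim h)
    show ?case
    proof
      fix y0 assume "y0 \<in> K"
      then have y0: "y0 \<in> cube n R" using KR by blast
      obtain Y where Y: "rk_stages A n f h y0 Y" and Yclose: "\<And>i. dist (Y i) y0 < r / 2"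
        using elim(3) y0 by blast
      have Ynear: "dist (Y i) y0 < r" for i
        using Yclose[of i] r by linarith
      have YRn: "Y i \<in> Rn n" for i
        using Y unfolding rk_stages_def by blast
      define yh where "yh = y0 + (h / 2) *\<^sub>R (\<Sum>i\<in>UNIV. b1 $ i *\<^sub>R f (Y i))"
      have ex: "\<exists>!Y. rk_stages A n f h y0 Y \<and> (\<forall>i. dist (Y i) y0 < r)"
        using elim(2) y0 by blast
      have theta: "rk_map A b n f r h y0 = Some (y0 + h *\<^sub>R (\<Sum>i\<in>UNIV. b $ i *\<^sub>R f (Y i)))"
        using ex Y Ynear by (rule rk_map_eqI)
      have phi: "rk_map A1 b1 n f r (h / 2) y0 = Some yh"
        unfolding yh_def using ex Y Ynear
        by (intro rk_map_eqI) (simp_all add: assms(4) rk_stages_rescale)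
      have "norm (f (Y i)) \<le> M" for i
        using Rn_cball_subset_cube[OF y0 YRn less_imp_le[OF Ynear]] by (rule M)
      then have "dist yh y0 \<le> \<bar>h / 2\<bar> * (\<Sum>j\<in>UNIV. \<bar>b1 $ j\<bar>) * M"
        by (auto simp only: yh_def dist_norm add_diff_cancel_left' intro!: norm_scaled_sum_le)
      then have yh: "dist yh y0 < 1" "dist yh y0 < r / 2"
        using elim(1) by (auto simp: mult.assoc)
      have "yh \<in> Rn n"
        unfolding yh_def using y0 YRn f
        by (auto simp: cube_def smooth_field_def intro!: subspace_add subspace_scale subspace_sum subspace_Rn)
      then have "yh \<in> cube n (R + 1)"
        using y0 yh by (intro Rn_cball_subset_cube[of y0]) auto
      moreover have "rk_stages A2 n f (h / 2) yh Y"
        unfolding assms(7) yh_def by (rule rk_stages_second_half[OF Y])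
      moreover have "dist (Y i) yh < r" for i
        using dist_triangle2[of "Y i" yh y0] Yclose[of i] yh by linarith
      ultimately have "rk_map A2 b2 n f r (h / 2) yh
          = Some (yh + (h / 2) *\<^sub>R (\<Sum>i\<in>UNIV. b2 $ i *\<^sub>R f (Y i)))"
        using elim(4) by (intro rk_map_eqI) auto
      moreover have "yh + (h / 2) *\<^sub>R (\<Sum>i\<in>UNIV. b2 $ i *\<^sub>R f (Y i))
          = y0 + h *\<^sub>R (\<Sum>i\<in>UNIV. b $ i *\<^sub>R f (Y i))"
      proof -
        have "yh + (h / 2) *\<^sub>R (\<Sum>i\<in>UNIV. b2 $ i *\<^sub>R f (Y i))
            = y0 + (h / 2) *\<^sub>R (\<Sum>i\<in>UNIV. (b1 $ i + b2 $ i) *\<^sub>R f (Y i))"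
          by (simp add: yh_def scaleR_add_left sum.distrib scaleR_add_right add.assoc)
        then show ?thesis
          by (simp add: bsum scaleR_sum_right)
      qed
      ultimately show "\<exists>y1. half_step_comp (rk_map A2 b2) (rk_map A1 b1) n f r h y0 = Some y1
          \<and> rk_map A b n f r h y0 = Some y1"
        using theta phi by (simp add: half_step_comp_def map_comp_def)
    qed
  qed
qed

end
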